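(* Let $X$ be a Tychonoff space. Then the map $F:\mathcal{C}_{pw}(X)\to \mathbf{Sub}_{1}(\mathrm{C}_{b}(X))$ induced by $F(f,Y)=\{g\circ f : g\in \mathrm{C}(Y)\}$ is a surjective order isomorphism (i.e. it is a well-defined bijection which preserves and reflects order). In particular, $\mathcal{C}_{pw}(X)$ is a complete lattice.
   Context: $\mathrm{C}_{b}(X)$ is the algebra of bounded continuous complex-valued functions on $X$, with the uniform norm and involution $f^{*}(x)=\overline{f(x)}$; for compact Hausdorff $Y$, $\mathrm{C}(Y)=\mathrm{C}_b(Y)$. A C$^*$-subalgebra of $\mathrm{C}_b(X)$ is a uniformly closed subalgebra closed under the involution; it is unital if it contains the constant function $1$. $\mathbf{Sub}_{1}(\mathrm{C}_{b}(X))$ is the set of all unital C$^*$-subalgebras of $\mathrm{C}_b(X)$, ordered by inclusion. A preweak compactification of $X$ is a pair $(f,Y)$ where $Y$ is a compact Hausdorff space and $f:X\to Y$ is a continuous map with dense range. For preweak compactifications, write $(f,Y)\geq (g,Z)$ if there is a continuous map $h:Y\to Z$ with $hf=g$; they are equivalent if there is a homeomorphism $h:Y\to Z$ with $hf=g$ (equivalently $(f,Y)\le(g,Z)$ and $(g,Z)\le (f,Y)$). $\mathcal{C}_{pw}(X)$ is the set of equivalence classes of preweak compactifications of $X$ with the partial order induced by $\leq$. *)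

theory Defs
  imports "HOL-Analysis.Analysis" "HOL-Algebra.Complete_Lattice"
begin

text \<open>
  Spaces are \<open>'a topology\<close> values, so a space need not exhaust its type and may be empty.
  Functions on \<open>X\<close> are \<open>extensional\<close> (arbitrary but fixed outside \<open>topspace X\<close>), which makes
  equality of functions in \<open>C\<^sub>b(X)\<close> mean equality at all points of \<open>X\<close>.
\<close>

text \<open>\<open>cfunspace\<close> is the library's metric space of bounded continuous maps with the
  supremum distance.\<close>

abbreviation Cb_metric :: "'a topology \<Rightarrow> ('a \<Rightarrow> complex) metric" where
  "Cb_metric X \<equiv> cfunspace X euclidean_metric"

definition Cb :: "'a topology \<Rightarrow> ('a \<Rightarrow> complex) set" where
  "Cb X = mspace (Cb_metric X)"

definition unital_cstar_subalgebra :: "'a topology \<Rightarrow> ('a \<Rightarrow> complex) set \<Rightarrow> bool" where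
  "unital_cstar_subalgebra X A \<longleftrightarrow>
     A \<subseteq> Cb X \<and>
     (\<lambda>x\<in>topspace X. 1) \<in> A \<and>
     (\<forall>f\<in>A. \<forall>g\<in>A. (\<lambda>x\<in>topspace X. f x + g x) \<in> A) \<and>
     (\<forall>c. \<forall>f\<in>A. (\<lambda>x\<in>topspace X. c * f x) \<in> A) \<and>
     (\<forall>f\<in>A. \<forall>g\<in>A. (\<lambda>x\<in>topspace X. f x * g x) \<in> A) \<and>
     (\<forall>f\<in>A. (\<lambda>x\<in>topspace X. cnj (f x)) \<in> A) \<and>
     closedin (mtopology_of (Cb_metric X)) A"

definition Sub1_Cb :: "'a topology \<Rightarrow> ('a \<Rightarrow> complex) set set" where
  "Sub1_Cb X = {A. unital_cstar_subalgebra X A}"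

definition preweak_compactification :: "'a topology \<Rightarrow> ('a \<Rightarrow> 'b) \<Rightarrow> 'b topology \<Rightarrow> bool" where
  "preweak_compactification X f Y \<longleftrightarrow>
     compact_space Y \<and> Hausdorff_space Y \<and> continuous_map X Y f \<and>
     Y closure_of (f ` topspace X) = topspace Y"

text \<open>\<open>(f,Y) \<ge> (g,Z)\<close>\<close>

definition pw_ge ::
  "'a topology \<Rightarrow> ('a \<Rightarrow> 'b) \<Rightarrow> 'b topology \<Rightarrow> ('a \<Rightarrow> 'c) \<Rightarrow> 'c topology \<Rightarrow> bool" where
  "pw_ge X f Y g Z \<longleftrightarrow> (\<exists>h. continuous_map Y Z h \<and> (\<forall>x\<in>topspace X. h (f x) = g x))"

definition pw_equiv ::
  "'a topology \<Rightarrow> ('a \<Rightarrow> 'b) \<Rightarrow> 'b topology \<Rightarrow> ('a \<Rightarrow> 'c) \<Rightarrow> 'c topology \<Rightarrow> bool" where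
  "pw_equiv X f Y g Z \<longleftrightarrow> (\<exists>h. homeomorphic_map Y Z h \<and> (\<forall>x\<in>topspace X. h (f x) = g x))"

text \<open>
  To form a set of equivalence classes, the compact spaces \<open>Y\<close> have to range over one type.
  The type \<open>'a set set\<close> is large enough for every preweak compactification of a space over
  \<open>'a\<close>: since \<open>f\<close> has dense range and \<open>Y\<close> is Hausdorff, \<open>y\<close> is determined by the family of all
  \<open>S \<subseteq> X\<close> with \<open>y\<close> in the closure of \<open>f(S)\<close>.
\<close>

type_synonym 'a pwc = "('a \<Rightarrow> 'a set set) \<times> 'a set set topology"

definition pw_compactifications :: "'a topology \<Rightarrow> 'a pwc set" where
  "pw_compactifications X = {(f, Y). preweak_compactification X f Y}"

definition pw_equiv_rel :: "'a topology \<Rightarrow> ('a pwc \<times> 'a pwc) set" where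
  "pw_equiv_rel X = {((f, Y), (g, Z)). preweak_compactification X f Y \<and>
      preweak_compactification X g Z \<and> pw_equiv X f Y g Z}"

definition Cpw :: "'a topology \<Rightarrow> 'a pwc set set" where
  "Cpw X = pw_compactifications X // pw_equiv_rel X"

definition Cpw_le :: "'a topology \<Rightarrow> 'a pwc set \<Rightarrow> 'a pwc set \<Rightarrow> bool" where
  "Cpw_le X P Q \<longleftrightarrow> (\<exists>(f, Y)\<in>P. \<exists>(g, Z)\<in>Q. pw_ge X g Z f Y)"

definition Cpw_order :: "'a topology \<Rightarrow> 'a pwc set gorder" where
  "Cpw_order X = \<lparr>carrier = Cpw X, eq = (=), le = Cpw_le X\<rparr>"

definition pw_algebra :: "'a topology \<Rightarrow> ('a \<Rightarrow> 'b) \<Rightarrow> 'b topology \<Rightarrow> ('a \<Rightarrow> complex) set" where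
  "pw_algebra X f Y = {restrict (g \<circ> f) (topspace X) | g. g \<in> Cb Y}"

text \<open>The map on classes induced by \<open>pw_algebra\<close>; it is the intended one once \<open>pw_algebra\<close> is
  known to be constant on each class.\<close>

definition Cpw_algebra :: "'a topology \<Rightarrow> 'a pwc set \<Rightarrow> ('a \<Rightarrow> complex) set" where
  "Cpw_algebra X P = the_elem (case_prod (pw_algebra X) ` P)"

lemma pw_equiv_refl: "pw_equiv X f Y f Y"
  unfolding pw_equiv_def by (rule exI[of _ id]) auto

lemma pw_equiv_trans:
  assumes "pw_equiv X f Y g Z" "pw_equiv X g Z k W"
  shows "pw_equiv X f Y k W"
proof -
  obtain h h' where h: "homeomorphic_map Y Z h" "\<forall>x\<in>topspace X. h (f x) = g x"
    and h': "homeomorphic_map Z W h'" "\<forall>x\<in>topspace X. h' (g x) = k x"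
    using assms unfolding pw_equiv_def by blast
  then show ?thesis
    unfolding pw_equiv_def
    by (intro exI[of _ "h' \<circ> h"]) (auto intro: homeomorphic_map_compose)
qed

lemma pw_equiv_sym:
  assumes "preweak_compactification X f Y" "pw_equiv X f Y g Z"
  shows "pw_equiv X g Z f Y"
proof -
  obtain h where h: "homeomorphic_map Y Z h" "\<forall>x\<in>topspace X. h (f x) = g x"
    using assms unfolding pw_equiv_def by blast
  then obtain h' where h': "homeomorphic_maps Y Z h h'"
    using homeomorphic_map_maps by blast
  then have "homeomorphic_map Z Y h'"
    using homeomorphic_maps_map by blast
  moreover have "h' (g x) = f x" if "x \<in> topspace X" for x
  proof -
    have "f x \<in> topspace Y"
      using assms(1) that unfolding preweak_compactification_def
      by (auto dest: continuous_map_image_subset_topspace)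
    then show ?thesis
      using h' h(2) that unfolding homeomorphic_maps_def by metis
  qed
  ultimately show ?thesis
    unfolding pw_equiv_def by blast
qed

lemma pw_equiv_imp_ge: "pw_equiv X f Y g Z \<Longrightarrow> pw_ge X f Y g Z"
  unfolding pw_equiv_def pw_ge_def using homeomorphic_imp_continuous_map by blast

lemma pw_ge_trans:
  assumes "pw_ge X f Y g Z" "pw_ge X g Z k W"
  shows "pw_ge X f Y k W"
proof -
  obtain h h' where "continuous_map Y Z h" "\<forall>x\<in>topspace X. h (f x) = g x"
    and "continuous_map Z W h'" "\<forall>x\<in>topspace X. h' (g x) = k x"
    using assms unfolding pw_ge_def by blast
  then show ?thesis
    unfolding pw_ge_def
    by (intro exI[of _ "h' \<circ> h"]) (auto intro: continuous_map_compose)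
qed

lemma equiv_pw_equiv_rel: "equiv (pw_compactifications X) (pw_equiv_rel X)"
proof (rule equivI)
  show "pw_equiv_rel X \<subseteq> pw_compactifications X \<times> pw_compactifications X"
    by (auto simp: pw_equiv_rel_def pw_compactifications_def)
  show "refl_on (pw_compactifications X) (pw_equiv_rel X)"
    by (auto simp: refl_on_def pw_equiv_rel_def pw_compactifications_def pw_equiv_refl)
  show "sym (pw_equiv_rel X)"
    by (auto simp: sym_def pw_equiv_rel_def intro: pw_equiv_sym)
  show "trans (pw_equiv_rel X)"
    unfolding trans_def pw_equiv_rel_def by (auto intro: pw_equiv_trans)
qed

text \<open>The order on classes does not depend on the representatives.\<close>

lemma Cpw_le_class_iff:
  fixes f g :: "'a \<Rightarrow> 'a set set"
  assumes "preweak_compactification X f Y" "preweak_compactification X g Z"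
  shows "Cpw_le X (pw_equiv_rel X `` {(f, Y)}) (pw_equiv_rel X `` {(g, Z)}) \<longleftrightarrow> pw_ge X g Z f Y"
proof
  assume "Cpw_le X (pw_equiv_rel X `` {(f, Y)}) (pw_equiv_rel X `` {(g, Z)})"
  then obtain f' g' :: "'a \<Rightarrow> 'a set set" and Y' Z' where *: "pw_equiv X f Y f' Y'" "pw_equiv X g Z g' Z'"
      "pw_ge X g' Z' f' Y'"
    unfolding Cpw_le_def pw_equiv_rel_def by auto
  then show "pw_ge X g Z f Y"
    using assms by (meson pw_equiv_imp_ge pw_equiv_sym pw_ge_trans)
next
  assume "pw_ge X g Z f Y"
  moreover have "(f, Y) \<in> pw_equiv_rel X `` {(f, Y)}" "(g, Z) \<in> pw_equiv_rel X `` {(g, Z)}"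
    using assms by (auto simp: pw_equiv_rel_def pw_equiv_refl)
  ultimately show "Cpw_le X (pw_equiv_rel X `` {(f, Y)}) (pw_equiv_rel X `` {(g, Z)})"
    unfolding Cpw_le_def by blast
qed

end

theory Submission
  imports Defs
begin

text \<open>
  The order on compactifications is read off from the algebras by a closure argument: if
  \<open>pw_algebra X f Y \<subseteq> pw_algebra X g Z\<close>, then the closure \<open>K\<close> of \<open>{(g x, f x)}\<close> in \<open>Z \<times> Y\<close> is the
  graph of a map \<open>Z \<rightarrow> Y\<close>, because every \<open>u \<in> C(Y)\<close> agrees along \<open>K\<close> with some \<open>v \<in> C(Z)\<close> and \<open>C(Y)\<close>
  separates points; the projection \<open>K \<rightarrow> Z\<close> is a continuous bijection of compact Hausdorff spaces,
  so the map is continuous. The same argument shows that \<open>pw_algebra X f Y\<close> is uniformly closed.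
  Conversely, a unital C*-subalgebra \<open>A\<close> is the algebra of the closure of \<open>X\<close> under the evaluation
  map into \<open>\<complex>\<^sup>A\<close>, by the Stone--Weierstrass theorem. Completeness of the lattice is inherited from
  \<open>Sub1_Cb X\<close>, which is closed under intersections.
\<close>

section \<open>Bounded continuous functions on compact spaces\<close>

lemma mem_Cb_iff:
  "f \<in> Cb X \<longleftrightarrow> f \<in> extensional (topspace X) \<and> continuous_map X euclidean f \<and> bounded (f ` topspace X)"
  unfolding Cb_def by auto

lemma mem_Cb_compact_iff:
  assumes "compact_space Y"
  shows "f \<in> Cb Y \<longleftrightarrow> f \<in> extensional (topspace Y) \<and> continuous_map Y euclidean f"
proof -
  have "bounded (f ` topspace Y)" if "continuous_map Y euclidean f"
    using image_compactin[OF _ that] assms compact_imp_bounded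
    unfolding compact_space_def compactin_euclidean_iff by blast
  then show ?thesis
    by (auto simp: mem_Cb_iff)
qed

lemma restrict_mem_Cb_compact:
  assumes "compact_space Y" "continuous_map Y euclidean f"
  shows "restrict f (topspace Y) \<in> Cb Y"
  using assms continuous_map_eq[of Y euclidean f "restrict f (topspace Y)"]
  by (simp add: mem_Cb_compact_iff)

lemma continuous_map_mem_topspace: "continuous_map X Y f \<Longrightarrow> x \<in> topspace X \<Longrightarrow> f x \<in> topspace Y"
  by (auto simp: continuous_map_def)

text \<open>A compact Hausdorff space is normal, hence completely regular, and its points are
  closed; a real function separating \<open>y\<close> from \<open>{z}\<close> is then read as a
  complex one.\<close>

lemma compact_Hausdorff_Cb_separates:
  assumes "compact_space Y" "Hausdorff_space Y" "y \<in> topspace Y" "z \<in> topspace Y" "y \<noteq> z"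
  obtains u where "u \<in> Cb Y" "u y \<noteq> u z"
proof -
  have "completely_regular_space Y"
    using assms compact_Hausdorff_or_regular_imp_normal_space normal_imp_completely_regular_space by blast
  moreover have "closedin Y {z}"
    using assms closedin_Hausdorff_singleton by metis
  ultimately obtain f :: "'a \<Rightarrow> real" where f: "continuous_map Y (top_of_set {0..1}) f" "f y = 0" "f z = 1"
    using assms unfolding completely_regular_space_def by (metis Diff_iff image_subset_iff singletonD singletonI)
  have "continuous_map Y euclidean (complex_of_real \<circ> f)"
    using f(1) continuous_map_into_fulltopology continuous_map_compose
    by (metis continuous_map_iff_continuous2 continuous_on_of_real_id)
  from restrict_mem_Cb_compact[OF assms(1) this] show thesis
    using that f assms by (auto simp: restrict_def split: if_splits)
qed

section \<open>Extension along a dense range and comparison of compactifications\<close>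

text \<open>Serves twice: with \<open>Z\<close> another compactification, to read the order off from
  the algebras, and with \<open>Z\<close> a closed disc of \<complex>, to extend a bounded function
  to \<open>Y\<close>.\<close>

lemma dense_range_extension:
  assumes Y: "compact_space Y" "Hausdorff_space Y" and Z: "compact_space Z" "Hausdorff_space Z"
    and f: "continuous_map X Y f" "Y closure_of (f ` topspace X) = topspace Y"
    and g: "continuous_map X Z g"
    and unique: "\<And>y z z'. (y, z) \<in> prod_topology Y Z closure_of ((\<lambda>x. (f x, g x)) ` topspace X) \<Longrightarrow>
      (y, z') \<in> prod_topology Y Z closure_of ((\<lambda>x. (f x, g x)) ` topspace X) \<Longrightarrow> z = z'"
  shows "pw_ge X f Y g Z"
proof -
  let ?P = "prod_topology Y Z"
  define K where "K = ?P closure_of ((\<lambda>x. (f x, g x)) ` topspace X)"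
  define W where "W = subtopology ?P K"
  have K: "closedin ?P K"
    by (simp add: K_def)
  then have tW: "topspace W = K"
    unfolding W_def by (intro topspace_subtopology_subset closedin_subset)
  have sub: "(f x, g x) \<in> K" if "x \<in> topspace X" for x
    using closure_of_subset_Int[of ?P "(\<lambda>x. (f x, g x)) ` topspace X"] f(1) g that
    unfolding K_def by (auto dest: continuous_map_mem_topspace)
  have W: "compact_space W"
    using K Y(1) Z(1) by (simp add: W_def closedin_compact_space compact_space_prod_topology compact_space_subtopology)
  have cont: "continuous_map W Y fst" "continuous_map W Z snd"
    by (auto simp: W_def continuous_map_from_subtopology continuous_map_fst continuous_map_snd)
  \<comment> \<open>A continuous map from a compact to a Hausdorff space is closed. This gives
    surjectivity, since the image is closed and contains the dense range of \<open>f\<close>, and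
    later continuity of the inverse.\<close>
  have closed: "closed_map W Y fst"
    using W Y(2) cont(1) continuous_imp_closed_map_gen Hausdorff_imp_kc_space by blast
  have "f ` topspace X \<subseteq> fst ` topspace W"
    using sub tW by force
  then have "fst ` topspace W = topspace Y"
    using closed f(2) cont(1) closure_of_minimal
    by (metis closed_map_def closedin_topspace continuous_map_image_subset_topspace subset_antisym)
  moreover have "inj_on fst (topspace W)"
    using unique unfolding tW K_def inj_on_def by force
  ultimately have "homeomorphic_map W Y fst"
    using cont(1) closed bijective_closed_imp_homeomorphic_map by blast
  then obtain k where k: "homeomorphic_maps W Y fst k"
    using homeomorphic_map_maps by blast
  then have "continuous_map Y Z (snd \<circ> k)"
    using cont(2) continuous_map_compose unfolding homeomorphic_maps_def by blast
  moreover have "(snd \<circ> k) (f x) = g x" if "x \<in> topspace X" for x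
    using k sub[OF that] tW unfolding homeomorphic_maps_def by force
  ultimately show ?thesis
    unfolding pw_ge_def by blast
qed

lemma pw_algebra_mono:
  assumes "preweak_compactification X f Y" "preweak_compactification X g Z" "pw_ge X g Z f Y"
  shows "pw_algebra X f Y \<subseteq> pw_algebra X g Z"
proof
  fix a assume "a \<in> pw_algebra X f Y"
  then obtain u where u: "u \<in> Cb Y" "a = restrict (u \<circ> f) (topspace X)"
    unfolding pw_algebra_def by blast
  obtain h where h: "continuous_map Z Y h" "\<forall>x\<in>topspace X. h (g x) = f x"
    using assms(3) unfolding pw_ge_def by blast
  have "compact_space Z" "continuous_map X Z g" "compact_space Y"
    using assms unfolding preweak_compactification_def by auto
  \<comment> \<open>Members of \<open>Cb Z\<close> are extensional, so the pullback is cut off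
    outside \<open>topspace Z\<close>; as \<open>g\<close> maps into \<open>topspace Z\<close>,
    composition with \<open>g\<close> does not see the cut.\<close>
  then have "restrict (u \<circ> h) (topspace Z) \<in> Cb Z"
    using u(1) h(1) by (metis restrict_mem_Cb_compact mem_Cb_iff continuous_map_compose)
  moreover have "a = restrict (restrict (u \<circ> h) (topspace Z) \<circ> g) (topspace X)"
    using h(2) u(2) continuous_map_mem_topspace[OF \<open>continuous_map X Z g\<close>]
    by (auto simp: fun_eq_iff restrict_def)
  ultimately show "a \<in> pw_algebra X g Z"
    unfolding pw_algebra_def by blast
qed

lemma pw_ge_if_pw_algebra_subset:
  assumes f: "preweak_compactification X f Y" and g: "preweak_compactification X g Z"
    and sub: "pw_algebra X f Y \<subseteq> pw_algebra X g Z"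
  shows "pw_ge X g Z f Y"
proof (rule dense_range_extension)
  let ?K = "prod_topology Z Y closure_of ((\<lambda>x. (g x, f x)) ` topspace X)"
  have Y: "compact_space Y" "Hausdorff_space Y" and Z: "compact_space Z"
    using f g unfolding preweak_compactification_def by auto
  fix z y y' assume K: "(z, y) \<in> ?K" "(z, y') \<in> ?K"
  then have top: "y \<in> topspace Y" "y' \<in> topspace Y"
    using closure_of_subset_topspace by fastforce+
  show "y = y'"
  proof (rule ccontr)
    assume "y \<noteq> y'"
    then obtain u where u: "u \<in> Cb Y" "u y \<noteq> u y'"
      using compact_Hausdorff_Cb_separates Y top by metis
    then have "restrict (u \<circ> f) (topspace X) \<in> pw_algebra X g Z"
      using sub unfolding pw_algebra_def by blast
    then obtain v where v: "v \<in> Cb Z" "restrict (u \<circ> f) (topspace X) = restrict (v \<circ> g) (topspace X)"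
      unfolding pw_algebra_def by blast
    then have uv: "u (f x) = v (g x)" if "x \<in> topspace X" for x
      using that by (metis comp_apply restrict_apply')
    \<comment> \<open>Both sides are continuous and agree on the graph, hence on its closure. Over
      the common point \<open>z\<close> this yields \<open>u y = v z = u y'\<close>, against the
      choice of \<open>u\<close>.\<close>
    have "(u \<circ> snd) p = (v \<circ> fst) p" if "p \<in> ?K" for p
    proof (rule forall_in_closure_of_eq[OF that])
      show "continuous_map (prod_topology Z Y) euclidean (u \<circ> snd)"
        using u(1) continuous_map_snd by (metis mem_Cb_iff continuous_map_compose)
      show "continuous_map (prod_topology Z Y) euclidean (v \<circ> fst)"
        using v(1) continuous_map_fst by (metis mem_Cb_iff continuous_map_compose)
    qed (use uv in auto)
    from this[OF K(1)] this[OF K(2)] show False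
      using u(2) by simp
  qed
qed (use f g in \<open>auto simp: preweak_compactification_def\<close>)

text \<open>The composite of the two comparison maps agrees with the identity on a dense range,
  hence everywhere because the space is Hausdorff.\<close>

lemma pw_equiv_if_pw_ge:
  assumes f: "preweak_compactification X f Y" and g: "preweak_compactification X g Z"
    and "pw_ge X f Y g Z" "pw_ge X g Z f Y"
  shows "pw_equiv X f Y g Z"
proof -
  \<comment> \<open>Stated for fresh maps and spaces so that it can be applied a second time with
    the two compactifications exchanged.\<close>
  have id: "k (h y) = y" 
    if "continuous_map Y Z h" "\<forall>x\<in>topspace X. h (f x) = g x"
      "continuous_map Z Y k" "\<forall>x\<in>topspace X. k (g x) = f x" "preweak_compactification X f Y" "y \<in> topspace Y"
    for h k y and f :: "'a \<Rightarrow> 'd" and g :: "'a \<Rightarrow> 'e" and Y Z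
  proof -
    have "(\<lambda>y. k (h y)) y = (\<lambda>y. y) y"
      by (rule forall_in_closure_of_eq[of y Y "f ` topspace X" Y])
        (use that continuous_map_compose[OF that(1,3)] in \<open>auto simp: preweak_compactification_def o_def simp del: continuous_map_id\<close>)
    then show ?thesis .
  qed
  obtain h k where h: "continuous_map Y Z h" "\<forall>x\<in>topspace X. h (f x) = g x"
    and k: "continuous_map Z Y k" "\<forall>x\<in>topspace X. k (g x) = f x"
    using assms(3,4) unfolding pw_ge_def by blast
  have "homeomorphic_maps Y Z h k"
    unfolding homeomorphic_maps_def using h k id[OF h k f] id[OF k h g] by blast
  then show ?thesis
    unfolding pw_equiv_def using h(2) homeomorphic_maps_map by blast
qed

section \<open>Uniform closedness and unital C*-subalgebras\<close>

text \<open>The supremum distance is at most \<open>e\<close> exactly when every pointwise distance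
  is. Closed balls are used because strict pointwise bounds need not survive the supremum.\<close>

lemma closedin_Cb_iff:
  assumes "S \<subseteq> Cb X"
  shows "closedin (mtopology_of (Cb_metric X)) S \<longleftrightarrow>
    (\<forall>f\<in>Cb X. (\<forall>e>0. \<exists>a\<in>S. \<forall>x\<in>topspace X. dist (f x) (a x) \<le> e) \<longrightarrow> f \<in> S)"
proof -
  interpret M: Metric_space "mspace (Cb_metric X)" "mdist (Cb_metric X)"
    by (rule Metric_space_mspace_mdist)
  have ball: "a \<in> M.mcball f e \<longleftrightarrow> (\<forall>x\<in>topspace X. dist (f x) (a x) \<le> e)"
    if "f \<in> Cb X" "a \<in> S" "e > 0" for f a e
  proof -
    have mem: "f \<in> mspace (Cb_metric X)" "a \<in> mspace (Cb_metric X)"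
      using that assms unfolding Cb_def by blast+
    then have "a \<in> M.mcball f e \<longleftrightarrow> mdist (Cb_metric X) f a \<le> e"
      unfolding M.in_mcball by blast
    also have "\<dots> \<longleftrightarrow> (\<forall>x\<in>topspace X. dist (f x) (a x) \<le> e)"
      using mdist_cfunspace_le[OF less_imp_le[OF that(3)], of X euclidean_metric f a]
        mdist_cfunspace_imp_mdist_le[OF mem, of e]
      unfolding mdist_euclidean_metric by blast
    finally show ?thesis .
  qed
  have "M.mtopology closure_of S =
      {f \<in> Cb X. \<forall>e>0. \<exists>a\<in>S. \<forall>x\<in>topspace X. dist (f x) (a x) \<le> e}"
    unfolding M.metric_closure_of_alt Cb_def
    by (intro Collect_cong conj_cong refl all_cong1 imp_cong bex_cong ball[unfolded Cb_def])
  moreover have "closedin M.mtopology S \<longleftrightarrow> M.mtopology closure_of S \<subseteq> S"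
    using assms closure_of_subset_eq[of S M.mtopology] unfolding Cb_def M.topspace_mtopology by blast
  ultimately show ?thesis
    unfolding mtopology_of_def by blast
qed

text \<open>Lets \<open>u\<close> be any continuous function in place of an extensional one, so that
  sums, products and conjugates of such \<open>u\<close> can be formed without truncating
  them.\<close>

lemma pw_algebra_eq:
  fixes f :: "'a \<Rightarrow> 'b"
  assumes "compact_space Y" "continuous_map X Y f"
  shows "pw_algebra X f Y = {restrict (u \<circ> f) (topspace X) | u :: 'b \<Rightarrow> complex. continuous_map Y euclidean u}"
proof (intro subset_antisym subsetI)
  fix a assume "a \<in> {restrict (u \<circ> f) (topspace X) | u :: 'b \<Rightarrow> complex. continuous_map Y euclidean u}"
  then obtain u where u: "continuous_map Y euclidean u" "a = restrict (u \<circ> f) (topspace X)"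
    by blast
  have "a = restrict (restrict u (topspace Y) \<circ> f) (topspace X)"
    using u(2) continuous_map_mem_topspace[OF assms(2)] by (auto simp: fun_eq_iff restrict_def)
  then show "a \<in> pw_algebra X f Y"
    unfolding pw_algebra_def using restrict_mem_Cb_compact[OF assms(1) u(1)] by blast
next
  fix a assume "a \<in> pw_algebra X f Y"
  then obtain u where "u \<in> Cb Y" "a = restrict (u \<circ> f) (topspace X)"
    unfolding pw_algebra_def by blast
  then show "a \<in> {restrict (u \<circ> f) (topspace X) | u :: 'b \<Rightarrow> complex. continuous_map Y euclidean u}"
    using mem_Cb_iff[of u Y] by blast
qed

lemma continuous_map_complex_mult:
  fixes u v :: "'a \<Rightarrow> complex"
  assumes "continuous_map Y euclidean u" "continuous_map Y euclidean v"
  shows "continuous_map Y euclidean (\<lambda>y. u y * v y)"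
proof -
  have "continuous_map euclidean euclidean (\<lambda>p::complex \<times> complex. fst p * snd p)"
    unfolding continuous_map_iff_continuous2 by (intro continuous_intros)
  from continuous_map_compose[OF _ this, of Y "\<lambda>y. (u y, v y)"] assms show ?thesis
    by (simp add: o_def continuous_map_paired flip: prod_topology_euclidean)
qed

lemma continuous_map_cnj:
  assumes "continuous_map Y euclidean u"
  shows "continuous_map Y euclidean (\<lambda>y. cnj (u y))"
proof -
  have "continuous_map euclidean euclidean cnj"
    unfolding continuous_map_iff_continuous2 by (intro continuous_intros)
  from continuous_map_compose[OF assms this] show ?thesis
    by (simp add: o_def)
qed

lemma unital_cstar_subalgebraI:
  assumes "A \<subseteq> Cb X" "closedin (mtopology_of (Cb_metric X)) A" "(\<lambda>x\<in>topspace X. 1) \<in> A"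
    "\<And>f g. f \<in> A \<Longrightarrow> g \<in> A \<Longrightarrow> (\<lambda>x\<in>topspace X. f x + g x) \<in> A"
    "\<And>f g. f \<in> A \<Longrightarrow> g \<in> A \<Longrightarrow> (\<lambda>x\<in>topspace X. f x * g x) \<in> A"
    "\<And>c f. f \<in> A \<Longrightarrow> (\<lambda>x\<in>topspace X. c * f x) \<in> A"
    "\<And>f. f \<in> A \<Longrightarrow> (\<lambda>x\<in>topspace X. cnj (f x)) \<in> A"
  shows "unital_cstar_subalgebra X A"
  unfolding unital_cstar_subalgebra_def by (intro conjI ballI allI assms)

text \<open>The algebraic operations are carried out on \<open>Y\<close>. The substance is uniform
  closedness: a uniform limit of functions that factor through \<open>f\<close> must itself factor
  through \<open>f\<close>.\<close>

lemma unital_cstar_subalgebra_pw_algebra: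
  assumes pw: "preweak_compactification X f Y"
  shows "unital_cstar_subalgebra X (pw_algebra X f Y)"
proof -
  have Y: "compact_space Y" "Hausdorff_space Y" and f: "continuous_map X Y f"
    using pw unfolding preweak_compactification_def by auto
  let ?A = "pw_algebra X f Y"
  have memI: "a \<in> ?A" if "continuous_map Y euclidean u" "a \<in> extensional (topspace X)"
    "\<And>x. x \<in> topspace X \<Longrightarrow> a x = u (f x)" for a u
  proof -
    have "a = restrict (u \<circ> f) (topspace X)"
      using that(2,3) by (intro extensionalityI[of a "topspace X"]) auto
    with that(1) have "\<exists>u. a = restrict (u \<circ> f) (topspace X) \<and> continuous_map Y euclidean u"
      by (intro exI[of _ u] conjI)
    then show ?thesis
      by (simp only: pw_algebra_eq[OF Y(1) f] mem_Collect_eq)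
  qed
  have memE: "\<exists>u. continuous_map Y euclidean u \<and> (\<forall>x\<in>topspace X. a x = u (f x))" if a: "a \<in> ?A" for a
  proof -
    obtain u where "continuous_map Y euclidean u" "a = restrict (u \<circ> f) (topspace X)"
      using a by (auto simp only: pw_algebra_eq[OF Y(1) f] mem_Collect_eq)
    then show ?thesis
      by (intro exI[of _ u]) simp
  qed
  have sub: "?A \<subseteq> Cb X"
  proof
    fix a assume "a \<in> ?A"
    then obtain u where u: "u \<in> Cb Y" "a = restrict (u \<circ> f) (topspace X)"
      unfolding pw_algebra_def by blast
    then have "continuous_map X euclidean (u \<circ> f)"
      using continuous_map_compose[OF f, of euclidean u] mem_Cb_iff[of u Y] by blast
    then have "continuous_map X euclidean a"
      using u(2) continuous_map_eq[of X euclidean "u \<circ> f" a] by simp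
    moreover have "a ` topspace X \<subseteq> u ` topspace Y"
      using continuous_map_mem_topspace[OF f] unfolding u(2) by auto
    then have "bounded (a ` topspace X)"
      using u(1) bounded_subset[of "u ` topspace Y"] unfolding mem_Cb_iff by blast
    ultimately show "a \<in> Cb X"
      using u(2) by (simp add: mem_Cb_iff)
  qed
  have "a \<in> ?A" if a: "a \<in> Cb X" and approx: "\<forall>e>0. \<exists>b\<in>?A. \<forall>x\<in>topspace X. dist (a x) (b x) \<le> e" for a
  proof -
    \<comment> \<open>The bound confines \<open>a\<close> to a closed disc, which is a compact
      Hausdorff target for the extension argument.\<close>
    obtain B where B: "a ` topspace X \<subseteq> cball 0 B"
      using a unfolding mem_Cb_iff bounded_iff by (auto simp: image_subset_iff)
    let ?Z = "top_of_set (cball (0::complex) B)"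
    let ?K = "prod_topology Y ?Z closure_of ((\<lambda>x. (f x, a x)) ` topspace X)"
    have "pw_ge X f Y a ?Z"
    proof (rule dense_range_extension)
      show "compact_space ?Z" "Hausdorff_space ?Z"
        by (auto simp: compact_space_subtopology Hausdorff_space_subtopology)
      show "continuous_map X ?Z a"
        using a B by (auto simp: continuous_map_in_subtopology mem_Cb_iff)
      fix y z z' assume K: "(y, z) \<in> ?K" "(y, z') \<in> ?K"
      \<comment> \<open>Take \<open>u\<close> on \<open>Y\<close> with \<open>u \<circ> f\<close>
        within \<open>e / 2\<close> of \<open>a\<close>. The inequality between \<open>snd p\<close>
        and \<open>u (fst p)\<close> is a closed condition, so it passes from the graph to its
        closure; two values over \<open>y\<close> are then both within \<open>e / 2\<close> of
        \<open>u y\<close>.\<close>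
      have "dist z z' \<le> e" if "e > 0" for e
      proof -
        obtain b where b: "b \<in> ?A" "\<forall>x\<in>topspace X. norm (a x - b x) \<le> e / 2"
          using approx half_gt_zero[OF \<open>e > 0\<close>] unfolding dist_norm by blast
        then obtain u where u: "continuous_map Y euclidean u" "\<forall>x\<in>topspace X. b x = u (f x)"
          using memE by blast
        have "continuous_map (prod_topology Y ?Z) euclidean (\<lambda>p. snd p - u (fst p))"
          using continuous_map_compose[OF continuous_map_fst u(1)]
            continuous_map_into_fulltopology[OF continuous_map_snd]
          by (intro continuous_map_diff) (auto simp: o_def)
        then have "closedin (prod_topology Y ?Z)
            {p \<in> topspace (prod_topology Y ?Z). snd p - u (fst p) \<in> cball 0 (e / 2)}"
          by (rule closedin_continuous_map_preimage) simp
        then have "snd p - u (fst p) \<in> cball 0 (e / 2)" if "p \<in> ?K" for p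
          by (rule forall_in_closure_of[OF that, rotated]) (use b(2) u(2) in \<open>auto simp: mem_cball_0\<close>)
        from this[OF K(1)] this[OF K(2)] have "norm (z - u y) \<le> e / 2" "norm (z' - u y) \<le> e / 2"
          unfolding mem_cball_0 fst_conv snd_conv .
        then show ?thesis
          using norm_triangle_ineq4[of "z - u y" "z' - u y"] unfolding dist_norm by simp
      qed
      then have "dist z z' \<le> 0"
        by (rule dense_ge)
      then show "z = z'"
        by simp
    qed (use pw in \<open>auto simp: preweak_compactification_def\<close>)
    then obtain h where h: "continuous_map Y ?Z h" "\<forall>x\<in>topspace X. h (f x) = a x"
      unfolding pw_ge_def by blast
    then show ?thesis
      using memI[OF continuous_map_into_fulltopology[OF h(1)], of a] a mem_Cb_iff[of a X] by simp
  qed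
  then have closed: "closedin (mtopology_of (Cb_metric X)) ?A"
    using closedin_Cb_iff[OF sub] by blast
  show ?thesis
  proof (rule unital_cstar_subalgebraI[OF sub closed])
    show "(\<lambda>x\<in>topspace X. 1) \<in> ?A"
      by (rule memI[of "\<lambda>_. 1"]) auto
  next
    fix a b assume "a \<in> ?A" "b \<in> ?A"
    then obtain u v where u: "continuous_map Y euclidean u" "\<forall>x\<in>topspace X. a x = u (f x)"
      and v: "continuous_map Y euclidean v" "\<forall>x\<in>topspace X. b x = v (f x)"
      using memE by metis
    show "(\<lambda>x\<in>topspace X. a x + b x) \<in> ?A"
      by (rule memI[OF continuous_map_add[OF u(1) v(1)]]) (use u v in auto)
    show "(\<lambda>x\<in>topspace X. a x * b x) \<in> ?A"
      by (rule memI[OF continuous_map_complex_mult[OF u(1) v(1)]]) (use u v in auto)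
  next
    fix c a assume "a \<in> ?A"
    then obtain u where u: "continuous_map Y euclidean u" "\<forall>x\<in>topspace X. a x = u (f x)"
      using memE by metis
    show "(\<lambda>x\<in>topspace X. c * a x) \<in> ?A"
      by (rule memI[OF continuous_map_complex_mult[OF _ u(1), of "\<lambda>_. c"]]) (use u in auto)
    show "(\<lambda>x\<in>topspace X. cnj (a x)) \<in> ?A"
      by (rule memI[OF continuous_map_cnj[OF u(1)]]) (use u in auto)
  qed
qed

text \<open>Provides the top element of the lattice.\<close>

lemma unital_cstar_subalgebra_Cb: "unital_cstar_subalgebra X (Cb X)"
proof -
  have memI: "restrict a (topspace X) \<in> Cb X"
    if "continuous_map X euclidean a" "\<And>x. x \<in> topspace X \<Longrightarrow> cmod (a x) \<le> M" for a M
    using that continuous_map_eq[OF that(1), of "restrict a (topspace X)"]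
    by (auto simp: mem_Cb_iff bounded_iff)
  have bound: "\<exists>M. \<forall>x\<in>topspace X. cmod (a x) \<le> M" and cont: "continuous_map X euclidean a"
    if "a \<in> Cb X" for a
    using that unfolding mem_Cb_iff bounded_iff by auto
  have closed: "closedin (mtopology_of (Cb_metric X)) (Cb X)"
    using closedin_Cb_iff[OF subset_refl] by blast
  show ?thesis
  proof (rule unital_cstar_subalgebraI[OF subset_refl closed])
    show "(\<lambda>x\<in>topspace X. 1) \<in> Cb X"
      by (rule memI[where M = 1]) auto
  next
    fix a b assume ab: "a \<in> Cb X" "b \<in> Cb X"
    obtain M N where M: "\<forall>x\<in>topspace X. cmod (a x) \<le> M" and N: "\<forall>x\<in>topspace X. cmod (b x) \<le> N"
      using bound ab by metis
    show "(\<lambda>x\<in>topspace X. a x + b x) \<in> Cb X"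
    proof (rule memI)
      show "continuous_map X euclidean (\<lambda>x. a x + b x)"
        by (intro continuous_map_add cont ab)
      show "cmod (a x + b x) \<le> M + N" if "x \<in> topspace X" for x
        using M N that by (intro norm_triangle_mono) auto
    qed
    show "(\<lambda>x\<in>topspace X. a x * b x) \<in> Cb X"
    proof (rule memI)
      show "continuous_map X euclidean (\<lambda>x. a x * b x)"
        by (intro continuous_map_complex_mult cont ab)
      \<comment> \<open>Monotonicity of multiplication needs \<open>0 \<le> M\<close>, which follows
        from the bound at the given \<open>x\<close>.\<close>
      show "cmod (a x * b x) \<le> M * N" if "x \<in> topspace X" for x
        unfolding norm_mult using M N that norm_ge_zero order_trans by (intro mult_mono) blast+
    qed
  next
    fix c a assume a: "a \<in> Cb X"
    obtain M where M: "\<forall>x\<in>topspace X. cmod (a x) \<le> M"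
      using bound a by metis
    show "(\<lambda>x\<in>topspace X. c * a x) \<in> Cb X"
    proof (rule memI)
      show "continuous_map X euclidean (\<lambda>x. c * a x)"
        by (rule continuous_map_complex_mult[OF _ cont[OF a]]) simp
      show "cmod (c * a x) \<le> cmod c * M" if "x \<in> topspace X" for x
        unfolding norm_mult using M that by (intro mult_left_mono) auto
    qed
    show "(\<lambda>x\<in>topspace X. cnj (a x)) \<in> Cb X"
    proof (rule memI)
      show "continuous_map X euclidean (\<lambda>x. cnj (a x))"
        by (intro continuous_map_cnj cont a)
      show "cmod (cnj (a x)) \<le> M" if "x \<in> topspace X" for x
        using M that by simp
    qed
  qed
qed

text \<open>Provides the infima of the lattice. The family is nonempty because
  \<open>\<Inter>{}\<close> is the whole function type, in general not contained in
  \<open>Cb X\<close>.\<close>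

lemma unital_cstar_subalgebra_Inter:
  assumes "\<A> \<noteq> {}" "\<And>A. A \<in> \<A> \<Longrightarrow> unital_cstar_subalgebra X A"
  shows "unital_cstar_subalgebra X (\<Inter>\<A>)"
proof -
  have "closedin (mtopology_of (Cb_metric X)) (\<Inter>\<A>)"
    using assms by (intro closedin_Inter) (auto simp: unital_cstar_subalgebra_def)
  moreover have "\<Inter>\<A> \<subseteq> Cb X"
    using assms unfolding unital_cstar_subalgebra_def by blast
  ultimately show ?thesis
    using assms(2) unfolding unital_cstar_subalgebra_def by simp
qed

section \<open>Stone--Weierstrass for compact Hausdorff topologies\<close>

text \<open>
  The library's Stone--Weierstrass theorem is stated for subsets of a type of class \<open>t2_space\<close>,
  and a function type \<open>'i \<Rightarrow> real\<close> is of that class only for countable \<open>'i\<close>. A copy of this type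
  with the product topology hosts every compact Hausdorff space, which carries the theorem over
  to \<open>'a topology\<close> values.
\<close>

typedef 'i real_family = "UNIV :: ('i \<Rightarrow> real) set"
  by simp

instantiation real_family :: (type) t2_space
begin

definition open_real_family :: "'a real_family set \<Rightarrow> bool" where
  "open_real_family U \<longleftrightarrow> open (Abs_real_family -` U)"

instance
proof
  show "open (UNIV :: 'a real_family set)"
    by (simp add: open_real_family_def)
  show "open (U \<inter> V)" if "open U" "open V" for U V :: "'a real_family set"
    using that by (simp add: open_real_family_def open_Int)
  show "open (\<Union>\<U>)" if "\<forall>U\<in>\<U>. open U" for \<U> :: "'a real_family set set"
    using that by (simp add: open_real_family_def vimage_Union open_UN)
  show "\<exists>U V. open U \<and> open V \<and> p \<in> U \<and> q \<in> V \<and> U \<inter> V = {}" if "p \<noteq> q" for p q :: "'a real_family"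
  proof -
    \<comment> \<open>Distinct families differ at a coordinate \<open>i\<close>; disjoint real
      neighbourhoods of the two values pull back along the continuous evaluation at
      \<open>i\<close>.\<close>
    obtain i where "Rep_real_family p i \<noteq> Rep_real_family q i"
      using \<open>p \<noteq> q\<close> Rep_real_family_inject by blast
    then obtain S T :: "real set" where ST: "open S" "open T"
      "Rep_real_family p i \<in> S" "Rep_real_family q i \<in> T" "S \<inter> T = {}"
      using hausdorff by metis
    have "open ((\<lambda>r. Rep_real_family r i) -` W)" if "open W" for W
    proof -
      have "Abs_real_family -` (\<lambda>r. Rep_real_family r i) -` W = (\<lambda>h. h i) -` W"
        by (auto simp: Abs_real_family_inverse)
      then show ?thesis
        using open_vimage[OF that continuous_on_product_coordinates] by (simp add: open_real_family_def)
    qed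
    then show ?thesis
      using ST by (intro exI[of _ "(\<lambda>r. Rep_real_family r i) -` S"] exI[of _ "(\<lambda>r. Rep_real_family r i) -` T"]) auto
  qed
qed

end

lemma continuous_map_Abs_real_family:
  assumes "continuous_map Y euclidean h"
  shows "continuous_map Y euclidean (\<lambda>y. Abs_real_family (h y))"
proof -
  have "openin Y {y \<in> topspace Y. h y \<in> Abs_real_family -` U}" if "open U" for U
    using openin_continuous_map_preimage[OF assms, of "Abs_real_family -` U"] that
    by (simp add: open_real_family_def)
  then show ?thesis
    by (simp add: continuous_map_def)
qed

text \<open>The functions in \<open>R\<close> serve as coordinates that embed \<open>Y\<close> as a
  compact set \<open>K\<close> of families. The class-based theorem is applied on \<open>K\<close>
  and its approximation is pulled back along the embedding.\<close>

lemma Stone_Weierstrass_topology: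
  fixes R :: "('b \<Rightarrow> real) set"
  assumes Y: "compact_space Y"
    and cont: "\<And>g. g \<in> R \<Longrightarrow> continuous_map Y euclidean g"
    and add: "\<And>g h. g \<in> R \<Longrightarrow> h \<in> R \<Longrightarrow> (\<lambda>y. g y + h y) \<in> R"
    and mult: "\<And>g h. g \<in> R \<Longrightarrow> h \<in> R \<Longrightarrow> (\<lambda>y. g y * h y) \<in> R"
    and const: "\<And>c. (\<lambda>_. c) \<in> R"
    and sep: "\<And>y z. y \<in> topspace Y \<Longrightarrow> z \<in> topspace Y \<Longrightarrow> y \<noteq> z \<Longrightarrow> \<exists>g\<in>R. g y \<noteq> g z"
    and f: "continuous_map Y euclidean f" and e: "e > 0"
  shows "\<exists>g\<in>R. \<forall>y\<in>topspace Y. \<bar>f y - g y\<bar> < e"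
proof -
  \<comment> \<open>The index type is that of all functions on \<open>Y\<close>; coordinates outside
    \<open>R\<close> are set to 0, so every coordinate is continuous.\<close>
  define E where "E y = Abs_real_family (\<lambda>g. if g \<in> R then g y else 0)" for y
  define K where "K = E ` topspace Y"
  have Rep_E: "Rep_real_family (E y) g = g y" if "g \<in> R" for y g
    using that by (simp add: E_def Abs_real_family_inverse)
  have "continuous_map Y (product_topology (\<lambda>_. euclidean) UNIV) (\<lambda>y g. if g \<in> R then g y else 0)"
  proof (rule continuous_map_coordinatewise_then_product)
    show "continuous_map Y euclidean (\<lambda>y. if g \<in> R then g y else 0)" for g
      using cont[of g] by (cases "g \<in> R") auto
  qed auto
  then have E: "continuous_map Y euclidean E"
    unfolding euclidean_product_topology E_def by (rule continuous_map_Abs_real_family)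
  then have EK: "continuous_map Y (top_of_set K) E"
    by (simp add: continuous_map_in_subtopology K_def)
  have "Hausdorff_space (euclidean :: ('b \<Rightarrow> real) real_family topology)"
    unfolding Hausdorff_space_def disjnt_def using hausdorff by fastforce
  have "inj_on E (topspace Y)"
    using sep Rep_E by (metis inj_onI)
  moreover have "closed_map Y (top_of_set K) E"
    using Y EK \<open>Hausdorff_space euclidean\<close>
    by (intro continuous_imp_closed_map_gen Hausdorff_imp_kc_space Hausdorff_space_subtopology)
  ultimately have "homeomorphic_map Y (top_of_set K) E"
    using EK by (intro bijective_closed_imp_homeomorphic_map) (simp_all add: K_def)
  then obtain k where "homeomorphic_maps Y (top_of_set K) E k"
    using homeomorphic_map_maps by blast
  then have k: "continuous_map (top_of_set K) Y k" "\<And>y. y \<in> topspace Y \<Longrightarrow> k (E y) = y"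
    unfolding homeomorphic_maps_def by auto
  have cont_k: "continuous_on K (\<lambda>p. g (k p))" if "continuous_map Y euclidean g" for g :: "'b \<Rightarrow> real"
    using continuous_map_compose[OF k(1) that] by (simp add: o_def)
  \<comment> \<open>Only the values on \<open>K\<close> are prescribed, so the ring axioms for
    \<open>R'\<close> reduce to those for \<open>R\<close> after substituting
    \<open>E y\<close>.\<close>
  define R' where "R' = {\<phi>. \<exists>g\<in>R. \<forall>y\<in>topspace Y. \<phi> (E y) = g y}"
  interpret function_ring_on R' K
  proof
    show "compact K"
      using Y image_compactin[OF _ E, of "topspace Y"] by (simp add: K_def compact_space_def)
    show "continuous_on K \<phi>" if "\<phi> \<in> R'" for \<phi>
    proof -
      obtain g where g: "g \<in> R" "\<forall>y\<in>topspace Y. \<phi> (E y) = g y"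
        using \<open>\<phi> \<in> R'\<close> unfolding R'_def by blast
      have "continuous_on K (\<lambda>p. g (k p)) \<longleftrightarrow> continuous_on K \<phi>"
        using g(2) k(2) by (intro continuous_on_cong) (auto simp: K_def)
      then show ?thesis
        using cont_k[OF cont[OF g(1)]] by blast
    qed
    fix \<phi> \<psi> assume "\<phi> \<in> R'" "\<psi> \<in> R'"
    then obtain g h where gh: "g \<in> R" "\<forall>y\<in>topspace Y. \<phi> (E y) = g y"
      "h \<in> R" "\<forall>y\<in>topspace Y. \<psi> (E y) = h y"
      unfolding R'_def by blast
    show "(\<lambda>p. \<phi> p + \<psi> p) \<in> R'"
      unfolding R'_def using gh by (intro CollectI bexI[OF _ add[OF gh(1,3)]]) simp
    show "(\<lambda>p. \<phi> p * \<psi> p) \<in> R'"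
      unfolding R'_def using gh by (intro CollectI bexI[OF _ mult[OF gh(1,3)]]) simp
  next
    show "(\<lambda>_. c) \<in> R'" for c
      unfolding R'_def by (intro CollectI bexI[OF _ const[of c]]) simp
  next
    fix p q assume "p \<in> K" "q \<in> K" "p \<noteq> q"
    then obtain y z where yz: "p = E y" "q = E z" "y \<in> topspace Y" "z \<in> topspace Y" "y \<noteq> z"
      unfolding K_def by blast
    then obtain g where g: "g \<in> R" "g y \<noteq> g z"
      using sep by blast
    \<comment> \<open>The coordinate function at \<open>g\<close> restricts to \<open>g\<close>
      along \<open>E\<close>, so it belongs to \<open>R'\<close> and separates the two
      points.\<close>
    then have "(\<lambda>p. Rep_real_family p g) \<in> R'"
      unfolding R'_def using Rep_E by blast
    then show "\<exists>\<phi>\<in>R'. \<phi> p \<noteq> \<phi> q"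
      by (rule bexI[rotated]) (simp add: yz Rep_E g)
  qed
  obtain \<phi> where \<phi>: "\<phi> \<in> R'" "\<forall>p\<in>K. \<bar>f (k p) - \<phi> p\<bar> < e"
    using Stone_Weierstrass_basic[OF cont_k[OF f] e] by blast
  then obtain g where g: "g \<in> R" "\<forall>y\<in>topspace Y. \<phi> (E y) = g y"
    unfolding R'_def by blast
  have "\<bar>f y - g y\<bar> < e" if "y \<in> topspace Y" for y
    using \<phi>(2) g(2) k(2)[OF that] that unfolding K_def by force
  with g(1) show ?thesis by blast
qed

section \<open>Recovering a subalgebra from its evaluation map\<close>

lemma unital_cstar_subalgebra_approx:
  assumes "unital_cstar_subalgebra X A" "f \<in> Cb X"
    and "\<And>e. e > 0 \<Longrightarrow> \<exists>a\<in>A. \<forall>x\<in>topspace X. dist (f x) (a x) \<le> e"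
  shows "f \<in> A"
  using assms closedin_Cb_iff[of A X] unfolding unital_cstar_subalgebra_def by blast

lemma unital_cstar_subalgebra_ops:
  assumes "unital_cstar_subalgebra X A"
  shows "f \<in> A \<Longrightarrow> g \<in> A \<Longrightarrow> (\<lambda>x\<in>topspace X. f x + g x) \<in> A"
    and "f \<in> A \<Longrightarrow> g \<in> A \<Longrightarrow> (\<lambda>x\<in>topspace X. f x * g x) \<in> A"
    and "f \<in> A \<Longrightarrow> (\<lambda>x\<in>topspace X. c * f x) \<in> A"
    and "f \<in> A \<Longrightarrow> (\<lambda>x\<in>topspace X. cnj (f x)) \<in> A"
    and "(\<lambda>x\<in>topspace X. 1) \<in> A"
  using assms unfolding unital_cstar_subalgebra_def by simp_all

text \<open>Prepares the reduction to real functions: the parts are \<open>(f + cnj f) / 2\<close>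
  and \<open>- \<i> (f - cnj f) / 2\<close>. The nested restrictions reproduce the terms that the
  closure rules produce.\<close>

lemma unital_cstar_subalgebra_Re_Im:
  assumes A: "unital_cstar_subalgebra X A" and f: "f \<in> A"
  shows "(\<lambda>x\<in>topspace X. complex_of_real (Re (f x))) \<in> A"
    and "(\<lambda>x\<in>topspace X. complex_of_real (Im (f x))) \<in> A"
proof -
  note ops = unital_cstar_subalgebra_ops[OF A]
  have "(\<lambda>x\<in>topspace X. complex_of_real (Re (f x))) =
      (\<lambda>x\<in>topspace X. 1 / 2 * (\<lambda>x\<in>topspace X. f x + (\<lambda>x\<in>topspace X. cnj (f x)) x) x)"
    by (rule restrict_ext) (simp add: complex_eq_iff)
  then show "(\<lambda>x\<in>topspace X. complex_of_real (Re (f x))) \<in> A"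
    using ops(3)[OF ops(1)[OF f ops(4)[OF f]], of "1 / 2"] by (simp only:)
  have "(\<lambda>x\<in>topspace X. complex_of_real (Im (f x))) =
      (\<lambda>x\<in>topspace X. - \<i> / 2 * (\<lambda>x\<in>topspace X. f x + (\<lambda>x\<in>topspace X. - 1 * (\<lambda>x\<in>topspace X. cnj (f x)) x) x) x)"
    by (rule restrict_ext) (simp add: complex_eq_iff)
  then show "(\<lambda>x\<in>topspace X. complex_of_real (Im (f x))) \<in> A"
    using ops(3)[OF ops(1)[OF f ops(3)[OF ops(4)[OF f], of "- 1"]], of "- \<i> / 2"] by (simp only:)
qed

text \<open>The evaluation map into the power of \<complex> indexed by \<open>A\<close>, realised on
  the full function type: the value 0 outside \<open>A\<close> makes the surplus coordinates
  constant.\<close>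

definition eval_map :: "('a \<Rightarrow> complex) set \<Rightarrow> 'a \<Rightarrow> ('a \<Rightarrow> complex) \<Rightarrow> complex" where
  "eval_map A x = (\<lambda>a. if a \<in> A then a x else 0)"

definition eval_closure :: "'a topology \<Rightarrow> ('a \<Rightarrow> complex) set \<Rightarrow> (('a \<Rightarrow> complex) \<Rightarrow> complex) set" where
  "eval_closure X A = closure (eval_map A ` topspace X)"

text \<open>Tychonoff's theorem: the set is a product of closed discs.\<close>

lemma compact_functions_bounded:
  fixes B :: "'i \<Rightarrow> real"
  shows "compact {k :: 'i \<Rightarrow> complex. \<forall>i. norm (k i) \<le> B i}"
proof -
  have "compactin (product_topology (\<lambda>i. euclidean) UNIV) (PiE UNIV (\<lambda>i. cball (0 :: complex) (B i)))"
    by (simp add: compactin_PiE)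
  then show ?thesis
    by (simp add: euclidean_product_topology PiE_UNIV_domain Pi_def)
qed

text \<open>Each \<open>a \<in> A\<close> is bounded and the other coordinates vanish, so the
  closure stays inside a product of closed discs. The second claim ensures that distinct points of
  the closure already differ at an index in \<open>A\<close>.\<close>

lemma
  assumes "A \<subseteq> Cb X"
  shows compact_eval_closure: "compact (eval_closure X A)"
    and eval_closure_eq_0: "k \<in> eval_closure X A \<Longrightarrow> a \<notin> A \<Longrightarrow> k a = 0"
proof -
  have "\<forall>a\<in>A. \<exists>B. \<forall>x\<in>topspace X. norm (a x) \<le> B"
    using assms mem_Cb_iff bounded_iff by (metis image_eqI subsetD)
  then obtain B where B: "\<And>a x. a \<in> A \<Longrightarrow> x \<in> topspace X \<Longrightarrow> norm (a x) \<le> B a"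
    by metis
  let ?C = "{k :: ('a \<Rightarrow> complex) \<Rightarrow> complex. \<forall>a. norm (k a) \<le> (if a \<in> A then B a else 0)}"
  have "compact ?C"
    by (rule compact_functions_bounded)
  have "continuous_on UNIV (\<lambda>k :: ('a \<Rightarrow> complex) \<Rightarrow> complex. norm (k a))" for a
    by (intro continuous_on_norm continuous_on_product_coordinates)
  then have "closed ?C"
    by (intro closed_Collect_all closed_Collect_le continuous_on_const)
  then have sub: "eval_closure X A \<subseteq> ?C"
    unfolding eval_closure_def using B by (intro closure_minimal) (auto simp: eval_map_def)
  then show "compact (eval_closure X A)"
    using compact_Int_closed[OF \<open>compact ?C\<close>, of "eval_closure X A"]
    by (simp add: inf_absorb2 eval_closure_def)
  show "k a = 0" if "k \<in> eval_closure X A" "a \<notin> A"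
  proof -
    have "norm (k a) \<le> (if a \<in> A then B a else 0)"
      using sub that(1) by blast
    with that(2) show ?thesis by simp
  qed
qed

lemma eval_map_mem: "x \<in> topspace X \<Longrightarrow> eval_map A x \<in> eval_closure X A"
  unfolding eval_closure_def by (rule subsetD[OF closure_subset imageI])

lemma continuous_map_eval_map:
  assumes "A \<subseteq> Cb X"
  shows "continuous_map X (top_of_set (eval_closure X A)) (eval_map A)"
proof -
  have "continuous_map X euclidean (\<lambda>x. eval_map A x a)" for a
    using assms mem_Cb_iff[of a X] by (cases "a \<in> A") (auto simp: eval_map_def)
  then have "continuous_map X (product_topology (\<lambda>i. euclidean) UNIV) (eval_map A)"
    by (auto intro: continuous_map_coordinatewise_then_product)
  then show ?thesis
    unfolding euclidean_product_topology by (simp add: continuous_map_in_subtopology image_subset_iff eval_map_mem)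
qed

lemma preweak_compactification_eval_map:
  assumes "A \<subseteq> Cb X"
  shows "preweak_compactification X (eval_map A) (top_of_set (eval_closure X A))"
proof -
  have "top_of_set (eval_closure X A) closure_of (eval_map A ` topspace X) = eval_closure X A"
  proof -
    have "eval_closure X A \<inter> eval_map A ` topspace X = eval_map A ` topspace X"
      using eval_map_mem[of _ X A] by blast
    then show ?thesis
      by (simp add: closure_of_subtopology eval_closure_def)
  qed
  moreover have "Hausdorff_space (euclidean :: (('a \<Rightarrow> complex) \<Rightarrow> complex) topology)"
    unfolding euclidean_product_topology[symmetric] by (simp add: Hausdorff_space_product_topology)
  ultimately show ?thesis
    unfolding preweak_compactification_def
    using compact_eval_closure[OF assms] continuous_map_eval_map[OF assms]
    by (simp add: compact_space_subtopology Hausdorff_space_subtopology)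
qed

text \<open>The continuous real functions on the closure whose pullback to \<open>X\<close> lies in
  \<open>A\<close> form a point-separating ring with constants. They approximate \<open>g\<close>
  uniformly, and \<open>A\<close> is uniformly closed.\<close>

lemma real_comp_eval_map_mem:
  assumes A: "unital_cstar_subalgebra X A" and g: "continuous_on (eval_closure X A) g"
  shows "(\<lambda>x\<in>topspace X. complex_of_real (g (eval_map A x))) \<in> A"
proof -
  note ops = unital_cstar_subalgebra_ops[OF A]
  have sub: "A \<subseteq> Cb X"
    using A by (simp add: unital_cstar_subalgebra_def)
  let ?K = "eval_closure X A"
  let ?pull = "\<lambda>\<phi>. \<lambda>x\<in>topspace X. complex_of_real (\<phi> (eval_map A x))"
  define R where "R = {\<phi>. continuous_on ?K \<phi> \<and> ?pull \<phi> \<in> A}"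
  \<comment> \<open>These are the separating functions: real and imaginary parts of coordinates,
    whose pullbacks are the real and imaginary parts of \<open>a\<close>.\<close>
  have coord: "(\<lambda>k. Re (k a)) \<in> R" "(\<lambda>k. Im (k a)) \<in> R" if a: "a \<in> A" for a
  proof -
    have "continuous_on ?K (\<lambda>k. k a)"
      by (rule continuous_on_subset[OF continuous_on_product_coordinates subset_UNIV])
    moreover have "?pull (\<lambda>k. Re (k a)) = (\<lambda>x\<in>topspace X. complex_of_real (Re (a x)))"
      "?pull (\<lambda>k. Im (k a)) = (\<lambda>x\<in>topspace X. complex_of_real (Im (a x)))"
      using a by (simp_all add: eval_map_def)
    ultimately show "(\<lambda>k. Re (k a)) \<in> R" "(\<lambda>k. Im (k a)) \<in> R"
      using unital_cstar_subalgebra_Re_Im[OF A a] by (auto simp: R_def intro: continuous_intros)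
  qed
  have approx: "\<exists>\<phi>\<in>R. \<forall>k\<in>topspace (top_of_set ?K). \<bar>g k - \<phi> k\<bar> < e" if "e > 0" for e
  proof (rule Stone_Weierstrass_topology)
    show "compact_space (top_of_set ?K)"
      using compact_eval_closure[OF sub] by (simp add: compact_space_subtopology)
    show "continuous_map (top_of_set ?K) euclidean g"
      using g by simp
    show "continuous_map (top_of_set ?K) euclidean \<phi>" if "\<phi> \<in> R" for \<phi>
      using that by (simp add: R_def)
    fix \<phi> \<psi> assume \<phi>: "\<phi> \<in> R" and \<psi>: "\<psi> \<in> R"
    have "?pull (\<lambda>k. \<phi> k + \<psi> k) = (\<lambda>x\<in>topspace X. ?pull \<phi> x + ?pull \<psi> x)"
      by (rule restrict_ext) simp
    then show "(\<lambda>k. \<phi> k + \<psi> k) \<in> R"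
      using \<phi> \<psi> ops(1)[of "?pull \<phi>" "?pull \<psi>"] by (simp only: R_def mem_Collect_eq continuous_on_add)
    have "?pull (\<lambda>k. \<phi> k * \<psi> k) = (\<lambda>x\<in>topspace X. ?pull \<phi> x * ?pull \<psi> x)"
      by (rule restrict_ext) simp
    then show "(\<lambda>k. \<phi> k * \<psi> k) \<in> R"
      using \<phi> \<psi> ops(2)[of "?pull \<phi>" "?pull \<psi>"] by (simp only: R_def mem_Collect_eq continuous_on_mult)
  next
    fix c :: real
    have "?pull (\<lambda>_. c) = (\<lambda>x\<in>topspace X. complex_of_real c * (\<lambda>x\<in>topspace X. 1) x)"
      by (rule restrict_ext) simp
    then show "(\<lambda>_. c) \<in> R"
      using ops(3)[OF ops(5)] by (simp only: R_def mem_Collect_eq continuous_on_const)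
  next
    fix k l assume kl: "k \<in> topspace (top_of_set ?K)" "l \<in> topspace (top_of_set ?K)" "k \<noteq> l"
    then obtain a where a: "k a \<noteq> l a"
      by blast
    then have "a \<in> A"
      using eval_closure_eq_0[OF sub, of k a] eval_closure_eq_0[OF sub, of l a] kl by auto
    then show "\<exists>\<phi>\<in>R. \<phi> k \<noteq> \<phi> l"
      using a coord complex_eq_iff by metis
  qed (rule that)
  \<comment> \<open>Closedness of \<open>A\<close> is relative to \<open>Cb X\<close>, so the
    pullback of \<open>g\<close> must first be shown continuous and bounded.\<close>
  have cont: "continuous_map X euclidean (?pull g)"
  proof -
    have "continuous_map (top_of_set ?K) euclidean (\<lambda>k. complex_of_real (g k))"
      using g by (simp add: continuous_on_of_real)
    from continuous_map_compose[OF continuous_map_eval_map[OF sub] this] show ?thesis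
      by (rule continuous_map_eq) simp
  qed
  have "bounded (g ` ?K)"
    using compact_continuous_image[OF g compact_eval_closure[OF sub]] compact_imp_bounded by blast
  then obtain B where "\<forall>k\<in>?K. \<bar>g k\<bar> \<le> B"
    unfolding bounded_iff by auto
  then have "bounded (?pull g ` topspace X)"
    unfolding bounded_iff using eval_map_mem[of _ X A] by (intro exI[of _ B]) auto
  with cont have "?pull g \<in> Cb X"
    by (simp add: mem_Cb_iff)
  then show ?thesis
  proof (rule unital_cstar_subalgebra_approx[OF A])
    fix e :: real assume "e > 0"
    then obtain \<phi> where \<phi>: "\<phi> \<in> R" "\<forall>k\<in>?K. \<bar>g k - \<phi> k\<bar> < e"
      using approx by auto
    have "dist (?pull g x) (?pull \<phi> x) \<le> e" if "x \<in> topspace X" for x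
      using \<phi>(2) eval_map_mem[OF that, of A] that
      by (simp add: dist_norm less_imp_le flip: of_real_diff)
    then show "\<exists>a\<in>A. \<forall>x\<in>topspace X. dist (?pull g x) (a x) \<le> e"
      using \<phi>(1) unfolding R_def by blast
  qed
qed

text \<open>A continuous function on the closure is split into real and imaginary parts, to which
  Stone--Weierstrass applies; conversely each \<open>a \<in> A\<close> is the pullback of its own
  coordinate.\<close>

lemma pw_algebra_eval_map:
  assumes A: "unital_cstar_subalgebra X A"
  shows "pw_algebra X (eval_map A) (top_of_set (eval_closure X A)) = A"
proof -
  note ops = unital_cstar_subalgebra_ops[OF A]
  have sub: "A \<subseteq> Cb X"
    using A by (simp add: unital_cstar_subalgebra_def)
  let ?K = "eval_closure X A"
  have eq: "pw_algebra X (eval_map A) (top_of_set ?K) =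
      {restrict (u \<circ> eval_map A) (topspace X) | u :: _ \<Rightarrow> complex. continuous_on ?K u}"
    using compact_eval_closure[OF sub] continuous_map_eval_map[OF sub]
    by (simp add: pw_algebra_eq compact_space_subtopology)
  show ?thesis
  proof (intro subset_antisym subsetI)
    fix a assume "a \<in> pw_algebra X (eval_map A) (top_of_set ?K)"
    then obtain u where u: "continuous_on ?K u" "a = restrict (u \<circ> eval_map A) (topspace X)"
      unfolding eq by blast
    let ?re = "\<lambda>x\<in>topspace X. complex_of_real (Re (u (eval_map A x)))"
    let ?im = "\<lambda>x\<in>topspace X. complex_of_real (Im (u (eval_map A x)))"
    have "a = (\<lambda>x\<in>topspace X. ?re x + (\<lambda>x\<in>topspace X. \<i> * ?im x) x)"
      unfolding u(2) by (rule restrict_ext) (simp add: complex_eq_iff)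
    moreover have "?re \<in> A" "?im \<in> A"
      using u(1) by (auto intro!: real_comp_eval_map_mem[OF A, of "\<lambda>k. Re (u k)"]
        real_comp_eval_map_mem[OF A, of "\<lambda>k. Im (u k)"] continuous_intros)
    ultimately show "a \<in> A"
      using ops(1)[OF _ ops(3), of ?re ?im \<i>] by (simp only:)
  next
    fix a assume a: "a \<in> A"
    then have "a \<in> extensional (topspace X)"
      using sub mem_Cb_iff[of a X] by blast
    then have "a = restrict ((\<lambda>k. k a) \<circ> eval_map A) (topspace X)"
      using a by (intro extensionalityI[of a "topspace X"]) (auto simp: eval_map_def)
    moreover have "continuous_on ?K (\<lambda>k. k a)"
      by (rule continuous_on_subset[OF continuous_on_product_coordinates subset_UNIV])
    ultimately show "a \<in> pw_algebra X (eval_map A) (top_of_set ?K)"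
      unfolding eq by (intro CollectI exI conjI)
  qed
qed

section \<open>Moving compactifications into a single type\<close>

lemma preweak_compactification_homeomorphic:
  assumes f: "preweak_compactification X f Y" and s: "homeomorphic_map Y Z s"
  shows "preweak_compactification X (s \<circ> f) Z" "pw_equiv X f Y (s \<circ> f) Z"
proof -
  have YZ: "Y homeomorphic_space Z"
    using s homeomorphic_map_imp_homeomorphic_space by blast
  have "f ` topspace X \<subseteq> topspace Y"
    using f continuous_map_image_subset_topspace unfolding preweak_compactification_def by blast
  then have "Z closure_of (s ` (f ` topspace X)) = topspace Z"
    using homeomorphic_map_closure_of[OF s] homeomorphic_imp_surjective_map[OF s] f
    by (simp add: preweak_compactification_def)
  then show "preweak_compactification X (s \<circ> f) Z"
    using f homeomorphic_compact_space[OF YZ] homeomorphic_Hausdorff_space[OF YZ]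
      continuous_map_compose[OF _ homeomorphic_imp_continuous_map[OF s], of X f]
    by (simp add: preweak_compactification_def image_comp)
  show "pw_equiv X f Y (s \<circ> f) Z"
    unfolding pw_equiv_def using s by auto
qed

text \<open>Transport of structure: the image of \<open>s\<close> receives the topology pulled back
  along the inverse of \<open>s\<close>.\<close>

lemma injective_homeomorphic_copy:
  assumes "inj_on s (topspace Y)"
  obtains Z where "homeomorphic_map Y Z s"
proof -
  let ?t = "inv_into (topspace Y) s"
  let ?Z = "pullback_topology (s ` topspace Y) ?t Y"
  have ts: "?t (s y) = y" if "y \<in> topspace Y" for y
    using assms that by simp
  have "continuous_map Y Y (?t \<circ> s)"
    using continuous_map_eq[OF continuous_map_id, of Y "?t \<circ> s"] ts by simp
  then have "continuous_map Y ?Z s"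
    by (rule continuous_map_pullback') auto
  moreover have "continuous_map ?Z Y ?t"
    using continuous_map_pullback[OF continuous_map_id, of "s ` topspace Y" ?t Y] by (simp add: o_def)
  moreover have "s (?t z) = z" if "z \<in> topspace ?Z" for z
    using that by (simp add: topspace_pullback_topology f_inv_into_f)
  ultimately have "homeomorphic_maps Y ?Z s ?t"
    unfolding homeomorphic_maps_def using ts by blast
  then show thesis
    using that homeomorphic_maps_map by blast
qed

lemma preweak_compactification_copy:
  fixes X :: "'a topology"
  assumes f: "preweak_compactification X f Y"
  obtains g :: "'a \<Rightarrow> 'a set set" and Z where "preweak_compactification X g Z" "pw_equiv X f Y g Z"
proof -
  define s where "s y = {S. S \<subseteq> topspace X \<and> y \<in> Y closure_of (f ` S)}" for y
  have Y: "Hausdorff_space Y" "Y closure_of (f ` topspace X) = topspace Y"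
    using f unfolding preweak_compactification_def by auto
  have "inj_on s (topspace Y)"
  proof (rule inj_onI, rule ccontr)
    fix y z assume yz: "y \<in> topspace Y" "z \<in> topspace Y" "s y = s z" "y \<noteq> z"
    then obtain U V where UV: "openin Y U" "openin Y V" "y \<in> U" "z \<in> V" "disjnt U V"
      using Y(1) unfolding Hausdorff_space_def by metis
    \<comment> \<open>The preimage of a neighbourhood of \<open>y\<close> tells \<open>y\<close> and
      \<open>z\<close> apart: density puts \<open>y\<close> in the closure of its image, while
      \<open>V\<close> is a neighbourhood of \<open>z\<close> missing that image.\<close>
    define S where "S = {x \<in> topspace X. f x \<in> U}"
    have "y \<in> Y closure_of (f ` S)"
      unfolding in_closure_of
    proof (intro conjI allI impI)
      fix W assume "y \<in> W \<and> openin Y W"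
      then have "openin Y (U \<inter> W)" "y \<in> U \<inter> W"
        using UV by auto
      moreover have "y \<in> Y closure_of (f ` topspace X)"
        using yz(1) Y(2) by simp
      ultimately obtain x where "x \<in> topspace X" "f x \<in> U \<inter> W"
        unfolding in_closure_of by blast
      then show "\<exists>w. w \<in> f ` S \<and> w \<in> W"
        unfolding S_def by blast
    qed (rule yz(1))
    then have "S \<in> s z"
      using yz(3) unfolding s_def S_def by blast
    then have "z \<in> Y closure_of (f ` S)"
      by (simp add: s_def)
    then obtain w where "w \<in> f ` S" "w \<in> V"
      using UV unfolding in_closure_of by blast
    then show False
      using UV(5) unfolding S_def disjnt_def by blast
  qed
  then obtain Z where "homeomorphic_map Y Z s"
    by (rule injective_homeomorphic_copy)
  from preweak_compactification_homeomorphic[OF f this] show thesis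
    by (rule that)
qed

section \<open>The induced map on equivalence classes\<close>

lemma pw_algebra_cong:
  assumes "preweak_compactification X f Y" "preweak_compactification X g Z" "pw_equiv X f Y g Z"
  shows "pw_algebra X f Y = pw_algebra X g Z"
  using assms by (meson pw_algebra_mono pw_equiv_imp_ge pw_equiv_sym subset_antisym)

text \<open>The algebra is constant on the class and the class is nonempty, so
  \<open>the_elem\<close> is applied to a genuine singleton.\<close>

lemma Cpw_algebra_class:
  assumes "preweak_compactification X f Y"
  shows "Cpw_algebra X (pw_equiv_rel X `` {(f, Y)}) = pw_algebra X f Y"
proof -
  let ?P = "pw_equiv_rel X `` {(f, Y)}"
  have mem: "(f, Y) \<in> ?P"
    using assms by (auto simp: pw_equiv_rel_def pw_equiv_refl)
  have const: "case_prod (pw_algebra X) p = pw_algebra X f Y" if p: "p \<in> ?P" for p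
  proof -
    obtain g Z where "p = (g, Z)" "preweak_compactification X g Z" "pw_equiv X f Y g Z"
      using p by (auto simp: pw_equiv_rel_def)
    then show ?thesis
      using pw_algebra_cong[OF assms, of g Z] by simp
  qed
  have "case_prod (pw_algebra X) ` ?P = (\<lambda>_. pw_algebra X f Y) ` ?P"
    using const by (rule image_cong[OF refl])
  also have "\<dots> = {pw_algebra X f Y}"
    using mem by (rule image_constant)
  finally show ?thesis
    unfolding Cpw_algebra_def by (simp only: the_elem_eq)
qed

lemma CpwE:
  assumes "P \<in> Cpw X"
  obtains f Y where "preweak_compactification X f Y" "P = pw_equiv_rel X `` {(f, Y)}"
  using assms unfolding Cpw_def pw_compactifications_def by (auto elim!: quotientE)

lemma Cpw_le_iff:
  assumes "P \<in> Cpw X" "Q \<in> Cpw X"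
  shows "Cpw_le X P Q \<longleftrightarrow> Cpw_algebra X P \<subseteq> Cpw_algebra X Q"
proof -
  obtain f Y g Z where f: "preweak_compactification X f Y" and P: "P = pw_equiv_rel X `` {(f, Y)}"
    and g: "preweak_compactification X g Z" and Q: "Q = pw_equiv_rel X `` {(g, Z)}"
    using assms CpwE by metis
  show ?thesis
    unfolding P Q Cpw_le_class_iff[OF f g] Cpw_algebra_class[OF f] Cpw_algebra_class[OF g]
    using pw_algebra_mono[OF f g] pw_ge_if_pw_algebra_subset[OF f g] by blast
qed

text \<open>Equal algebras give comparison maps in both directions, hence equivalent
  compactifications; a given subalgebra is attained at the closure of its evaluation map.\<close>

lemma bij_betw_Cpw_algebra: "bij_betw (Cpw_algebra X) (Cpw X) (Sub1_Cb X)"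
proof (rule bij_betwI')
  fix P Q assume "P \<in> Cpw X" "Q \<in> Cpw X"
  then obtain f Y g Z where f: "preweak_compactification X f Y" and P: "P = pw_equiv_rel X `` {(f, Y)}"
    and g: "preweak_compactification X g Z" and Q: "Q = pw_equiv_rel X `` {(g, Z)}"
    using CpwE by metis
  have "P = Q" if "Cpw_algebra X P = Cpw_algebra X Q"
  proof -
    have eq: "pw_algebra X f Y = pw_algebra X g Z"
      using that unfolding P Q Cpw_algebra_class[OF f] Cpw_algebra_class[OF g] .
    have "pw_equiv X f Y g Z"
      by (intro pw_equiv_if_pw_ge[OF f g] pw_ge_if_pw_algebra_subset f g) (simp_all add: eq)
    then have "((f, Y), (g, Z)) \<in> pw_equiv_rel X"
      using f g by (simp add: pw_equiv_rel_def)
    then show ?thesis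
      unfolding P Q by (rule equiv_class_eq[OF equiv_pw_equiv_rel])
  qed
  then show "Cpw_algebra X P = Cpw_algebra X Q \<longleftrightarrow> P = Q"
    by blast
next
  fix P assume "P \<in> Cpw X"
  then show "Cpw_algebra X P \<in> Sub1_Cb X"
    by (auto elim!: CpwE simp: Cpw_algebra_class Sub1_Cb_def unital_cstar_subalgebra_pw_algebra)
next
  fix A assume "A \<in> Sub1_Cb X"
  then have A: "unital_cstar_subalgebra X A" and sub: "A \<subseteq> Cb X"
    by (auto simp: Sub1_Cb_def unital_cstar_subalgebra_def)
  \<comment> \<open>The evaluation closure lives in a function type, so an equivalent copy over the
    type used by \<open>Cpw\<close> takes its place.\<close>
  obtain g :: "'a \<Rightarrow> 'a set set" and Z where g: "preweak_compactification X g Z"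
    and "pw_equiv X (eval_map A) (top_of_set (eval_closure X A)) g Z"
    using preweak_compactification_copy[OF preweak_compactification_eval_map[OF sub]] by blast
  then have "pw_algebra X g Z = A"
    using pw_algebra_cong[OF preweak_compactification_eval_map[OF sub]] pw_algebra_eval_map[OF A] by metis
  moreover have "pw_equiv_rel X `` {(g, Z)} \<in> Cpw X"
    unfolding Cpw_def using g by (intro quotientI) (simp add: pw_compactifications_def)
  ultimately show "\<exists>P\<in>Cpw X. A = Cpw_algebra X P"
    using Cpw_algebra_class[OF g] by metis
qed

section \<open>Completeness of the lattice and the isomorphism theorem\<close>

lemma complete_lattice_Cpw_order: "complete_lattice (Cpw_order X)"
proof -
  have alg: "Cpw_algebra X P \<in> Sub1_Cb X" if "P \<in> Cpw X" for P
    using bij_betw_Cpw_algebra[of X] that by (auto simp: bij_betw_def)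
  have inj: "P = Q" if "P \<in> Cpw X" "Q \<in> Cpw X" "Cpw_algebra X P = Cpw_algebra X Q" for P Q
    using bij_betw_Cpw_algebra[of X] that by (auto simp: bij_betw_def inj_on_def)
  have surj: "\<exists>P\<in>Cpw X. Cpw_algebra X P = A" if "A \<in> Sub1_Cb X" for A
    using bij_betw_imp_surj_on[OF bij_betw_Cpw_algebra, of X] that by (metis imageE)
  have antisym: "P = Q" if "Cpw_le X P Q" "Cpw_le X Q P" "P \<in> Cpw X" "Q \<in> Cpw X" for P Q
    using that by (intro inj) (simp_all add: Cpw_le_iff)
  have trans: "Cpw_le X P R"
    if "Cpw_le X P Q" "Cpw_le X Q R" "P \<in> Cpw X" "Q \<in> Cpw X" "R \<in> Cpw X" for P Q R
    using that by (simp add: Cpw_le_iff)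
  have refl: "Cpw_le X P P" if "P \<in> Cpw X" for P
    using that by (simp add: Cpw_le_iff)
  interpret partial_order "Cpw_order X"
    by unfold_locales (simp_all add: Cpw_order_def antisym trans refl)
  show ?thesis
  \<comment> \<open>A greatest element and infima of nonempty families suffice. They are the
    preimages, under the order isomorphism, of \<open>Cb X\<close> and of intersections.\<close>
  proof (rule complete_lattice_criterion1)
    obtain T where "T \<in> Cpw X" "Cpw_algebra X T = Cb X"
      using surj[of "Cb X"] unital_cstar_subalgebra_Cb by (auto simp: Sub1_Cb_def)
    moreover have "Cpw_algebra X P \<subseteq> Cb X" if "P \<in> Cpw X" for P
      using alg[OF that] by (simp add: Sub1_Cb_def unital_cstar_subalgebra_def)
    ultimately have "greatest (Cpw_order X) T (carrier (Cpw_order X))"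
      by (simp add: greatest_def Cpw_order_def Cpw_le_iff)
    then show "\<exists>g. greatest (Cpw_order X) g (carrier (Cpw_order X))" ..
  next
    fix \<P> assume "\<P> \<subseteq> carrier (Cpw_order X)" "\<P> \<noteq> {}"
    then have \<P>: "\<P> \<subseteq> Cpw X" "\<P> \<noteq> {}"
      by (simp_all add: Cpw_order_def)
    have "unital_cstar_subalgebra X (\<Inter>(Cpw_algebra X ` \<P>))"
      using \<P> alg by (intro unital_cstar_subalgebra_Inter) (auto simp: Sub1_Cb_def)
    then obtain I where I: "I \<in> Cpw X" "Cpw_algebra X I = \<Inter>(Cpw_algebra X ` \<P>)"
      using surj[of "\<Inter>(Cpw_algebra X ` \<P>)"] by (auto simp: Sub1_Cb_def)
    have "Cpw_le X I P" if "P \<in> \<P>" for P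
    proof -
      have "P \<in> Cpw X"
        using that \<P>(1) by blast
      then show ?thesis
        unfolding Cpw_le_iff[OF I(1) \<open>P \<in> Cpw X\<close>] I(2) using that by blast
    qed
    moreover have "Cpw_le X Q I" if Q: "Q \<in> Cpw X" "\<forall>P\<in>\<P>. Cpw_le X Q P" for Q
    proof -
      have "Cpw_algebra X Q \<subseteq> Cpw_algebra X P" if "P \<in> \<P>" for P
        using that Q \<P>(1) Cpw_le_iff[OF Q(1), of P] by blast
      then show ?thesis
        unfolding Cpw_le_iff[OF Q(1) I(1)] I(2) by blast
    qed
    ultimately have "greatest (Cpw_order X) I (Lower (Cpw_order X) \<P>)"
      using I(1) \<P>(1) by (auto simp: greatest_def Lower_def Cpw_order_def)
    then show "\<exists>i. greatest (Cpw_order X) i (Lower (Cpw_order X) \<P>)" ..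
  qed
qed

text \<open>The first conjunct justifies passing from \<open>pw_algebra\<close> to
  \<open>Cpw_algebra\<close>. The last one shows that confining the compact spaces to the type
  \<open>'a set set\<close> loses no compactification up to equivalence.\<close>

theorem theorem3p4:
  fixes X :: "'a topology"
  assumes "completely_regular_space X" and "Hausdorff_space X"
  shows "case_prod (pw_algebra X) respects pw_equiv_rel X
    \<and> bij_betw (Cpw_algebra X) (Cpw X) (Sub1_Cb X)
    \<and> (\<forall>P\<in>Cpw X. \<forall>Q\<in>Cpw X. Cpw_le X P Q \<longleftrightarrow> Cpw_algebra X P \<subseteq> Cpw_algebra X Q)
    \<and> complete_lattice (Cpw_order X)
    \<and> (\<forall>(f :: 'a \<Rightarrow> 'b) Y. preweak_compactification X f Y \<longrightarrow>
         (\<exists>(g, Z)\<in>pw_compactifications X. pw_equiv X f Y g Z \<and> pw_algebra X f Y = pw_algebra X g Z))"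
proof (intro conjI ballI allI impI)
  show "case_prod (pw_algebra X) respects pw_equiv_rel X"
    by (rule congruentI) (clarsimp simp: pw_equiv_rel_def, rule pw_algebra_cong)
  show "bij_betw (Cpw_algebra X) (Cpw X) (Sub1_Cb X)"
    by (rule bij_betw_Cpw_algebra)
  show "complete_lattice (Cpw_order X)"
    by (rule complete_lattice_Cpw_order)
  show "Cpw_le X P Q \<longleftrightarrow> Cpw_algebra X P \<subseteq> Cpw_algebra X Q" if "P \<in> Cpw X" "Q \<in> Cpw X" for P Q
    using that by (rule Cpw_le_iff)
  fix f :: "'a \<Rightarrow> 'b" and Y assume f: "preweak_compactification X f Y"
  then obtain g :: "'a \<Rightarrow> 'a set set" and Z
    where g: "preweak_compactification X g Z" "pw_equiv X f Y g Z"
    by (rule preweak_compactification_copy)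
  then show "\<exists>(g, Z)\<in>pw_compactifications X. pw_equiv X f Y g Z \<and> pw_algebra X f Y = pw_algebra X g Z"
    using pw_algebra_cong[OF f g] by (auto simp: pw_compactifications_def)
qed

end
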